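(* Let $$C=1+\sqrt{2}\sum_{k=1}^{\infty}\frac{(-1)^{k+1}}{(2k-1)8^k}\binom{2k}{k}\,\zeta\!\left(k-\tfrac{1}{2}\right).$$ Then, as $n\to\infty$ through the odd positive integers, $$\sum_{j=1}^n(-1)^{j+1}\sqrt{jn}=\frac{n}{2}+C\sqrt{n}+\frac{1}{8}+O\left(\frac{1}{n}\right).$$ That is, there is an absolute constant $K>0$ such that for every odd integer $n\geq 1$, $$\left|\sum_{j=1}^n(-1)^{j+1}\sqrt{jn}-\frac{n}{2}-C\sqrt{n}-\frac{1}{8}\right|\leq\frac{K}{n}.$$
   Context: $\zeta(s)$ denotes the Riemann zeta function; for $k=1$ the value $\zeta(1/2)$ is that of its analytic continuation. Numerically, $C\simeq 0.3801$. *)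

theory Defs
  imports "HOL-Complex_Analysis.Complex_Analysis"
begin

(* The analytic continuation of the Dirichlet series to the plane punctured at the
   pole s = 1. By the identity theorem it is unique on that (connected) set; the
   clause at s = 1 only fixes the junk value at the pole, so that THE is determined. *)
definition riemann_zeta :: "complex \<Rightarrow> complex" where
  "riemann_zeta = (THE f. f holomorphic_on (- {1}) \<and>
     (\<forall>s. Re s > 1 \<longrightarrow> f s = (\<Sum>m. 1 / of_nat (Suc m) powr s)) \<and>
     f 1 = 0)"

(* zeta is real on the real axis, so Re loses nothing here *)
definition riemann_zeta_real :: "real \<Rightarrow> real" where
  "riemann_zeta_real x = Re (riemann_zeta (complex_of_real x))"

definition C_summand :: "nat \<Rightarrow> real" where
  "C_summand k = (-1) ^ (k + 1) / ((2 * real k - 1) * 8 ^ k) * real ((2 * k) choose k)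
     * riemann_zeta_real (real k - 1/2)"

(* Suc shifts the library's summation from 0 to the range k = 1, 2, ... *)
definition C_const :: real where
  "C_const = 1 + sqrt 2 * (\<Sum>k. C_summand (Suc k))"

end

(* With S(n) the alternating sum of sqrt j, the difference S(2M+1) - sqrt(2M+1)/2 - 1/(8 sqrt(2M+1))
   has increments of order M^(-7/2), so it converges, with error O(M^(-3/2)), and it only remains to
   identify its limit as C. Pairing consecutive terms, S(2M+1) - 1 is the sum of
   sqrt(2m+1) - sqrt(2m) over 1 <= m <= M. Expanding by the binomial series in 1/(2m) and summing over
   m, the k-th term tends to the k-th term of C for k >= 2, and for k = 1 the divergence of
   the sum of m^(-1/2) is exactly compensated by zeta(1/2) = lim (sum_{m<=M} m^(-1/2) - 2 sqrt(M+1)).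

   The continuation of zeta comes from summing over n the Taylor expansion of (n+1)^(1-s) at n:
   this expresses (s-1) zeta(s) by the values of the same function at s+1, s+2, ... and a remainder
   that is holomorphic on a half-plane as large as desired. *)
theory Submission
  imports Defs
begin

section \<open>Taylor remainders of the power function between consecutive integers\<close>

text \<open>Taylor remainder of order \<open>K\<close> for \<open>x powr (1 - s)\<close>, expanded
  at \<open>n + 1\<close> and evaluated at \<open>n + 2\<close>; the shift keeps the centre away
  from 0.\<close>

definition powr_step_rem :: "nat \<Rightarrow> nat \<Rightarrow> complex \<Rightarrow> complex" where
  "powr_step_rem K n s = of_nat (Suc (Suc n)) powr (1 - s) -
     (\<Sum>k\<le>K. ((1 - s) gchoose k) * of_nat (Suc n) powr (1 - s - of_nat k))"

lemma gbinomial_mult_diff: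
  fixes a :: "'a::field_char_0"
  shows "(a gchoose k) * (a - of_nat k) = of_nat (Suc k) * (a gchoose Suc k)"
  using gbinomial_mult_1'[of a k] by (simp add: algebra_simps)

lemma holomorphic_on_gbinomial [holomorphic_intros]:
  "f holomorphic_on A \<Longrightarrow> (\<lambda>z. f z gchoose k) holomorphic_on A"
  unfolding gbinomial_prod_rev by (intro holomorphic_intros) auto

text \<open>Taylor's bound on the segment from \<open>n + 1\<close> to \<open>n + 2\<close>: under
  the hypothesis the exponent \<open>- Re s - K\<close> is nonpositive, so the derivative of order
  \<open>K + 1\<close> is largest at the left end. The factor \<open>Suc K\<close> is (K+1)!/K!, as
  \<open>complex_Taylor\<close> divides only by K!.\<close>

lemma norm_powr_step_rem_le:
  assumes s: "Re s + real K \<ge> 0"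
  shows "norm (powr_step_rem K n s)
    \<le> real (Suc K) * norm ((1 - s) gchoose Suc K) * real (Suc n) powr (- Re s - real K)"
proof -
  define a where "a = 1 - s"
  \<comment> \<open>\<open>f i\<close> is the derivative of order \<open>i\<close> of
    \<open>z powr a\<close>.\<close>
  define f where "f = (\<lambda>i (z::complex). fact i * (a gchoose i) * z powr (a - of_nat i))"
  define S where "S = closed_segment (of_nat (Suc n) :: complex) (of_nat (Suc (Suc n)))"
  define B where "B = fact (Suc K) * norm (a gchoose Suc K) * real (Suc n) powr (- Re s - real K)"
  have S: "\<exists>x\<ge>real (Suc n). z = of_real x" if "z \<in> S" for z
  proof -
    obtain u where u: "0 \<le> u" "z = (1 - of_real u) * of_nat (Suc n) + of_real u * of_nat (Suc (Suc n))"
      using \<open>z \<in> S\<close> by (auto simp: S_def in_segment scaleR_conv_of_real)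
    have "z = of_real (real (Suc n) + u)"
      by (simp add: u algebra_simps)
    with u(1) show ?thesis
      by (intro exI[of _ "real (Suc n) + u"]) auto
  qed
  have "norm (f 0 (of_nat (Suc (Suc n))) - (\<Sum>i\<le>K. f i (of_nat (Suc n)) *
          (of_nat (Suc (Suc n)) - of_nat (Suc n)) ^ i / fact i))
        \<le> B * norm (of_nat (Suc (Suc n)) - of_nat (Suc n) :: complex) ^ Suc K / fact K"
  proof (rule complex_Taylor[of S])
    fix i z assume z: "z \<in> S" "i \<le> K"
    obtain x where x: "x \<ge> real (Suc n)" "z = of_real x"
      using S z by blast
    \<comment> \<open>The segment avoids the branch cut of \<open>powr\<close>.\<close>
    have nz: "z \<notin> \<real>\<^sub>\<le>\<^sub>0"
      using x by (auto simp: complex_nonpos_Reals_iff)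
    have "(f i has_field_derivative fact i * (a gchoose i) * ((a - of_nat i) * z powr (a - of_nat i - 1)))
            (at z within S)"
      unfolding f_def using nz
      by (rule has_field_derivative_at_within[OF DERIV_cmult[OF has_field_derivative_powr]])
    moreover have "fact i * (a gchoose i) * ((a - of_nat i) * z powr (a - of_nat i - 1)) = f (Suc i) z"
    proof -
      have "fact i * (a gchoose i) * ((a - of_nat i) * z powr (a - of_nat i - 1)) =
              fact i * ((a gchoose i) * (a - of_nat i)) * z powr (a - of_nat i - 1)"
        by (simp only: mult_ac)
      also have "\<dots> = f (Suc i) z"
        unfolding gbinomial_mult_diff by (simp add: f_def algebra_simps)
      finally show ?thesis .
    qed
    ultimately show "(f i has_field_derivative f (Suc i) z) (at z within S)"
      by simp
  next
    fix z assume "z \<in> S"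
    then obtain x where x: "x \<ge> real (Suc n)" "z = of_real x"
      using S by blast
    have "norm (z powr (a - of_nat (Suc K))) = x powr (- Re s - real K)"
      using x by (subst norm_powr_real_powr) (auto simp: a_def)
    also have "\<dots> \<le> real (Suc n) powr (- Re s - real K)"
      using x s by (intro powr_mono2') auto
    finally show "norm (f (Suc K) z) \<le> B"
      unfolding f_def B_def norm_mult norm_fact by (intro mult_left_mono) auto
  qed (auto simp: S_def)
  also have "f 0 (of_nat (Suc (Suc n))) - (\<Sum>i\<le>K. f i (of_nat (Suc n)) *
          (of_nat (Suc (Suc n)) - of_nat (Suc n)) ^ i / fact i) = powr_step_rem K n s"
    by (simp add: f_def powr_step_rem_def a_def)
  also have "B * norm (of_nat (Suc (Suc n)) - of_nat (Suc n) :: complex) ^ Suc K / fact K =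
     real (Suc K) * norm ((1 - s) gchoose Suc K) * real (Suc n) powr (- Re s - real K)"
    by (simp add: B_def a_def)
  finally show ?thesis .
qed

lemma summable_powr_Suc:
  assumes "a < -1"
  shows "summable (\<lambda>n. real (Suc n) powr a)"
  using assms summable_real_powr_iff[of a] summable_Suc_iff[of "\<lambda>n. real n powr a"] by simp

lemma summable_powr_step_rem:
  assumes s: "Re s + real K > 1"
  shows "summable (\<lambda>n. powr_step_rem K n s)"
proof (rule summable_comparison_test')
  show "summable (\<lambda>n. real (Suc K) * norm ((1 - s) gchoose Suc K) * real (Suc n) powr (- Re s - real K))"
    using s by (intro summable_mult summable_powr_Suc) auto
  show "norm (powr_step_rem K n s) \<le>
          real (Suc K) * norm ((1 - s) gchoose Suc K) * real (Suc n) powr (- Re s - real K)" for n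
    using s by (intro norm_powr_step_rem_le) auto
qed

text \<open>Every summand is entire in \<open>s\<close>, and the Taylor bound gives locally uniform
  convergence by the M-test.\<close>

lemma holomorphic_on_suminf_powr_step_rem:
  "(\<lambda>s. \<Sum>n. powr_step_rem K n s) holomorphic_on {s. Re s > 1 - real K}"
proof (rule holomorphic_uniform_sequence)
  show "open {s. Re s > 1 - real K}"
    by (rule open_halfspace_Re_gt)
  show "(\<lambda>s. \<Sum>i<n. powr_step_rem K i s) holomorphic_on {s. Re s > 1 - real K}" for n
    unfolding powr_step_rem_def by (intro holomorphic_intros)
  fix z assume z: "z \<in> {s. Re s > 1 - real K}"
  \<comment> \<open>Half the distance from \<open>z\<close> to the boundary line: on the ball the
    exponent \<open>- Re w - K\<close> is then at most \<open>- 1 - d\<close>, which is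
    summable.\<close>
  define d where "d = (Re z - (1 - real K)) / 2"
  have d: "d > 0"
    using z by (simp add: d_def)
  have Re_ge: "Re w \<ge> 1 - real K + d" if "w \<in> cball z d" for w
  proof -
    have "Re z - Re w \<le> norm (z - w)"
      using complex_Re_le_cmod[of "z - w"] by simp
    with that show ?thesis
      by (simp add: d_def dist_norm field_simps)
  qed
  have "continuous_on (cball z d) (\<lambda>w. real (Suc K) * norm ((1 - w) gchoose Suc K))"
    by (intro continuous_intros holomorphic_on_imp_continuous_on holomorphic_intros)
  hence "bounded ((\<lambda>w. real (Suc K) * norm ((1 - w) gchoose Suc K)) ` cball z d)"
    by (intro compact_imp_bounded compact_continuous_image compact_cball)
  then obtain B where B: "\<bar>real (Suc K) * norm ((1 - w) gchoose Suc K)\<bar> \<le> B" if "w \<in> cball z d" for w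
    unfolding bounded_iff real_norm_def by blast
  have "uniform_limit (cball z d) (\<lambda>n s. \<Sum>i<n. powr_step_rem K i s)
          (\<lambda>s. \<Sum>n. powr_step_rem K n s) sequentially"
  proof (rule Weierstrass_m_test)
    show "summable (\<lambda>n. B * real (Suc n) powr (- 1 - d))"
      using d by (intro summable_mult summable_powr_Suc) auto
    fix n w assume w: "w \<in> cball z d"
    have "norm (powr_step_rem K n w) \<le>
       real (Suc K) * norm ((1 - w) gchoose Suc K) * real (Suc n) powr (- Re w - real K)"
      using Re_ge[OF w] d by (intro norm_powr_step_rem_le) auto
    also have "\<dots> \<le> B * real (Suc n) powr (- 1 - d)"
      using Re_ge[OF w] order_trans[OF abs_ge_zero B[OF w]] by (intro mult_mono powr_mono order_trans[OF abs_ge_self B[OF w]]) auto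
    finally show "norm (powr_step_rem K n w) \<le> B * real (Suc n) powr (- 1 - d)" .
  qed
  moreover have "cball z d \<subseteq> {s. Re s > 1 - real K}"
    using Re_ge d by fastforce
  ultimately show "\<exists>d>0. cball z d \<subseteq> {s. Re s > 1 - real K} \<and>
      uniform_limit (cball z d) (\<lambda>n s. \<Sum>i<n. powr_step_rem K i s)
          (\<lambda>s. \<Sum>n. powr_step_rem K n s) sequentially"
    using d by blast
qed

section \<open>Analytic continuation of the zeta function\<close>

abbreviation dirichlet :: "complex \<Rightarrow> complex" where
  "dirichlet s \<equiv> \<Sum>m. 1 / of_nat (Suc m) powr s"

lemma summable_dirichlet:
  assumes "Re s > 1"
  shows "summable (\<lambda>m. 1 / of_nat (Suc m) powr s)"
proof (rule summable_norm_cancel)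
  have "norm (1 / of_nat (Suc m) powr s) = real (Suc m) powr (- Re s)" for m
    using norm_powr_real_powr[of "of_nat (Suc m)" s]
    by (simp add: norm_divide powr_minus field_simps)
  thus "summable (\<lambda>m. norm (1 / of_nat (Suc m) powr s))"
    using summable_powr_Suc[of "- Re s"] assms by simp
qed

lemma powr_one_minus_tendsto_0:
  assumes "Re s > 1"
  shows "(\<lambda>n. of_nat (Suc n) powr (1 - s)) \<longlonglongrightarrow> 0"
proof (rule tendsto_norm_zero_cancel)
  have "(\<lambda>n. real (Suc n) powr (1 - Re s)) \<longlonglongrightarrow> 0"
    using assms by real_asymp
  moreover have "norm (of_nat (Suc n) powr (1 - s)) = real (Suc n) powr (1 - Re s)" for n
    using norm_powr_real_powr[of "of_nat (Suc n)" "1 - s"] by simp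
  ultimately show "(\<lambda>n. norm (of_nat (Suc n) powr (1 - s))) \<longlonglongrightarrow> 0"
    by simp
qed

text \<open>The term \<open>k = 0\<close> telescopes against
  \<open>of_nat (Suc (Suc n)) powr (1 - s)\<close> and leaves -1; each \<open>k \<ge> 1\<close>
  gives a Dirichlet series at a point of real part above 1.\<close>

lemma suminf_powr_step_rem:
  assumes s: "Re s > 1"
  shows "(\<Sum>n. powr_step_rem K n s) =
    -1 - (\<Sum>k=1..K. ((1 - s) gchoose k) * dirichlet (s + of_nat k - 1))"
proof -
  have "(\<lambda>n. of_nat (Suc (Suc n)) powr (1 - s) - of_nat (Suc n) powr (1 - s)) sums
          (0 - of_nat (Suc 0) powr (1 - s))"
    using telescope_sums[OF powr_one_minus_tendsto_0[OF s]] by simp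
  moreover have "(\<lambda>n. \<Sum>k=1..K. ((1 - s) gchoose k) * (1 / of_nat (Suc n) powr (s + of_nat k - 1))) sums
          (\<Sum>k=1..K. ((1 - s) gchoose k) * dirichlet (s + of_nat k - 1))"
    using s by (intro sums_sum sums_mult summable_sums summable_dirichlet) auto
  ultimately have "(\<lambda>n. of_nat (Suc (Suc n)) powr (1 - s) - of_nat (Suc n) powr (1 - s) -
      (\<Sum>k=1..K. ((1 - s) gchoose k) * (1 / of_nat (Suc n) powr (s + of_nat k - 1)))) sums
      (0 - of_nat (Suc 0) powr (1 - s) - (\<Sum>k=1..K. ((1 - s) gchoose k) * dirichlet (s + of_nat k - 1)))"
    by (rule sums_diff)
  moreover have "of_nat (Suc (Suc n)) powr (1 - s) - of_nat (Suc n) powr (1 - s) -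
      (\<Sum>k=1..K. ((1 - s) gchoose k) * (1 / of_nat (Suc n) powr (s + of_nat k - 1))) = powr_step_rem K n s" for n
  proof -
    have "(\<Sum>k\<le>K. ((1 - s) gchoose k) * of_nat (Suc n) powr (1 - s - of_nat k)) =
       of_nat (Suc n) powr (1 - s) + (\<Sum>k=1..K. ((1 - s) gchoose k) * of_nat (Suc n) powr (1 - s - of_nat k))"
      by (simp add: atMost_atLeast0 sum.atLeast_Suc_atMost)
    moreover have "of_nat (Suc n) powr (1 - s - of_nat k) = 1 / of_nat (Suc n) powr (s + of_nat k - 1)" for k
      using powr_minus[of "of_nat (Suc n) :: complex" "s + of_nat k - 1"]
      by (simp add: field_simps del: of_nat_Suc)
    ultimately show ?thesis
      by (simp add: powr_step_rem_def)
  qed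
  ultimately show ?thesis
    by (simp add: sums_iff)
qed

text \<open>Putting \<open>k = j + 1\<close> and splitting the factor \<open>1 - s - j\<close> off
  the binomial coefficient turns every term into a value of (s-1) zeta(s) at \<open>s + j\<close>.
  This function has no pole, so the relation can be used as a recursion for continuing it.\<close>

lemma suminf_powr_step_rem':
  assumes s: "Re s > 1"
  shows "(\<Sum>n. powr_step_rem (Suc K) n s) =
    -1 + (s - 1) * dirichlet s +
    (\<Sum>j=1..K. ((1 - s) gchoose j) / of_nat (Suc j) * ((s + of_nat j - 1) * dirichlet (s + of_nat j)))"
proof -
  have *: "((1 - s) gchoose Suc j) * dirichlet (s + of_nat (Suc j) - 1) =
     - (((1 - s) gchoose j) / of_nat (Suc j) * ((s + of_nat j - 1) * dirichlet (s + of_nat j)))" for j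
  proof -
    have "((1 - s) gchoose Suc j) = ((1 - s) gchoose j) * (1 - s - of_nat j) / of_nat (Suc j)"
      by (simp add: gbinomial_mult_diff del: of_nat_Suc)
    moreover have "s + of_nat (Suc j) - 1 = s + of_nat j"
      by simp
    moreover have "1 - s - of_nat j = - (s + of_nat j - 1)"
      by simp
    ultimately show ?thesis
      by (simp only: mult_minus_right mult_minus_left minus_divide_left [symmetric] times_divide_eq_left
            times_divide_eq_right mult.assoc)
  qed
  have "(\<Sum>k=1..Suc K. ((1 - s) gchoose k) * dirichlet (s + of_nat k - 1)) =
     (\<Sum>j=0..K. ((1 - s) gchoose Suc j) * dirichlet (s + of_nat (Suc j) - 1))"
    using sum.atLeast_Suc_atMost_Suc_shift[of "\<lambda>k. ((1 - s) gchoose k) * dirichlet (s + of_nat k - 1)" 0 K]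
    by simp
  also have "\<dots> = (1 - s) * dirichlet s
      - (\<Sum>j=1..K. ((1 - s) gchoose j) / of_nat (Suc j) * ((s + of_nat j - 1) * dirichlet (s + of_nat j)))"
    unfolding * sum_negf by (subst sum.atLeast_Suc_atMost) (auto simp: algebra_simps)
  finally show ?thesis
    unfolding suminf_powr_step_rem[OF s] by (simp add: algebra_simps)
qed

text \<open>Each induction step gains a strip of width 1: for \<open>j \<ge> 1\<close> the values at
  \<open>s + j\<close> are already available, and the remainder of order \<open>M + 2\<close>
  converges for \<open>Re s > - (M + 1)\<close>.\<close>

lemma half_plane_extension:
  "\<exists>G. G holomorphic_on {s. Re s > - real M} \<and> (\<forall>s. Re s > 1 \<longrightarrow> G s = (s - 1) * dirichlet s)"
proof (induction M)
  case 0
  show ?case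
  proof (intro exI conjI allI impI)
    show "(\<lambda>s. 1 + (\<Sum>n. powr_step_rem 1 n s)) holomorphic_on {s. Re s > - real 0}"
      using holomorphic_on_suminf_powr_step_rem[of 1] by (intro holomorphic_intros) auto
    show "1 + (\<Sum>n. powr_step_rem 1 n s) = (s - 1) * dirichlet s" if "Re s > 1" for s
      using suminf_powr_step_rem'[OF that, of 0] by simp
  qed
next
  case (Suc M)
  then obtain G where hol: "G holomorphic_on {s. Re s > - real M}"
    and G: "\<And>s. Re s > 1 \<Longrightarrow> G s = (s - 1) * dirichlet s"
    by blast
  define H where "H = (\<lambda>s. 1 - (\<Sum>j=1..Suc M. ((1 - s) gchoose j) / of_nat (Suc j) * G (s + of_nat j))
      + (\<Sum>n. powr_step_rem (Suc (Suc M)) n s))"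
  have "(\<lambda>s. G (s + of_nat j)) holomorphic_on {s. Re s > - real (Suc M)}" if "j \<ge> 1" for j
    using that by (intro holomorphic_on_compose_gen[OF _ hol, unfolded o_def] holomorphic_intros) auto
  hence "H holomorphic_on {s. Re s > - real (Suc M)}"
    unfolding H_def using holomorphic_on_suminf_powr_step_rem[of "Suc (Suc M)"]
    by (intro holomorphic_intros) auto
  moreover have "H s = (s - 1) * dirichlet s" if "Re s > 1" for s
    using that suminf_powr_step_rem'[OF that, of "Suc M"] G by (simp add: H_def)
  ultimately show ?case
    by blast
qed

text \<open>The extensions to the nested half-planes agree by the identity theorem, starting from
  \<open>Re s > 1\<close>, and can be glued.\<close>

lemma entire_extension:
  "\<exists>G. G holomorphic_on UNIV \<and> (\<forall>s. Re s > 1 \<longrightarrow> G s = (s - 1) * dirichlet s)"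
proof -
  obtain G where hol: "\<And>M. G M holomorphic_on {s. Re s > - real M}"
    and G: "\<And>M s. Re s > 1 \<Longrightarrow> G M s = (s - 1) * dirichlet s"
    using half_plane_extension by metis
  have le: "G M s = G N s" if "Re s > - real M" "M \<le> N" for M N s
  proof (rule analytic_continuation_open[where s = "{s. Re s > 1}" and s' = "{s. Re s > - real M}" and f = "G M" and g = "G N"])
    show "{s. Re s > 1} \<noteq> {}"
      by (auto intro: exI[of _ 2])
    show "G N holomorphic_on {s. Re s > - real M}"
      using that by (intro holomorphic_on_subset[OF hol[of N]]) auto
  qed (use that hol G in \<open>auto intro: open_halfspace_Re_gt convex_connected convex_halfspace_Re_gt\<close>)
  \<comment> \<open>The index is chosen so that its half-plane contains \<open>s\<close>.\<close>
  define H where "H = (\<lambda>s. G (nat (\<lceil>- Re s\<rceil> + 1)) s)"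
  have H: "H s = G N s" if "Re s > - real N" for s N
  proof -
    have "Re s > - real (nat (\<lceil>- Re s\<rceil> + 1))"
      by linarith
    thus ?thesis
      using le that by (metis H_def nle_le)
  qed
  have "H holomorphic_on (\<Union>N. {s. Re s > - real N})"
  proof (rule holomorphic_on_UN_open)
    show "H holomorphic_on {s. Re s > - real N}" for N
      by (rule holomorphic_transform[OF hol[of N]]) (simp add: H[of N])
  qed (rule open_halfspace_Re_gt)
  moreover have "(\<Union>N. {s. Re s > - real N}) = UNIV"
  proof (intro equalityI subsetI UN_I)
    show "s \<in> {t. Re t > - real (nat (\<lceil>- Re s\<rceil> + 1))}" for s
      by (simp, linarith)
  qed auto
  moreover have "H s = (s - 1) * dirichlet s" if "Re s > 1" for s
    using H[of 0 s] G[of s] that by simp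
  ultimately show ?thesis
    by metis
qed

text \<open>Shows that the description in the definition has exactly one solution: existence by
  dividing the entire function by \<open>s - 1\<close>, uniqueness by the identity theorem on the
  connected punctured plane.\<close>

lemma riemann_zeta_props:
  "riemann_zeta holomorphic_on (- {1}) \<and>
     (\<forall>s. Re s > 1 \<longrightarrow> riemann_zeta s = dirichlet s) \<and> riemann_zeta 1 = 0"
proof -
  obtain G where hol: "G holomorphic_on UNIV" and G: "\<And>s. Re s > 1 \<Longrightarrow> G s = (s - 1) * dirichlet s"
    using entire_extension by blast
  have "\<exists>!f. f holomorphic_on (- {1}) \<and> (\<forall>s. Re s > 1 \<longrightarrow> f s = dirichlet s) \<and> f 1 = 0"
  \<comment> \<open>At \<open>s = 1\<close> division by zero yields 0, precisely the value
    prescribed there.\<close>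
  proof (rule ex1I[of _ "\<lambda>s. G s / (s - 1)"])
    have "G s / (s - 1) = dirichlet s" if "Re s > 1" for s
      using G[OF that] that by auto
    thus "(\<lambda>s. G s / (s - 1)) holomorphic_on (- {1}) \<and>
        (\<forall>s. Re s > 1 \<longrightarrow> G s / (s - 1) = dirichlet s) \<and> G 1 / (1 - 1) = 0"
      using holomorphic_on_subset[OF hol] by (auto intro!: holomorphic_intros)
  next
    fix f assume f: "f holomorphic_on (- {1}) \<and> (\<forall>s. Re s > 1 \<longrightarrow> f s = dirichlet s) \<and> f 1 = 0"
    show "f = (\<lambda>s. G s / (s - 1))"
    proof
      fix s
      show "f s = G s / (s - 1)"
      proof (cases "s = 1")
        case False
        show ?thesis
        proof (rule analytic_continuation_open[where s = "{s. Re s > 1}" and s' = "- {1}" and f = f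
            and g = "\<lambda>s. G s / (s - 1)"])
          show "{s. Re s > 1} \<noteq> {}"
            by (auto intro: exI[of _ 2])
          show "connected (- {1 :: complex})"
            by (rule connected_punctured_universe) simp
          show "(\<lambda>s. G s / (s - 1)) holomorphic_on (- {1})"
            using holomorphic_on_subset[OF hol] by (auto intro!: holomorphic_intros)
          show "f z = G z / (z - 1)" if "z \<in> {s. Re s > 1}" for z
            using f G[of z] that by auto
        qed (use f False in \<open>auto intro: open_halfspace_Re_gt\<close>)
      qed (use f in auto)
    qed
  qed
  from theI'[OF this] show ?thesis
    unfolding riemann_zeta_def .
qed

section \<open>Zeta at 1/2 and on the real half-line beyond 1\<close>

text \<open>For \<open>K = 1\<close> no shifted values of zeta occur and the remainder series is
  holomorphic on \<open>Re s > 0\<close>, so the identity passes from \<open>Re s > 1\<close> to a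
  region containing 1/2.\<close>

lemma riemann_zeta_eq_suminf_powr_step_rem:
  assumes "Re s > 0" "s \<noteq> 1"
  shows "(s - 1) * riemann_zeta s = 1 + (\<Sum>n. powr_step_rem 1 n s)"
proof (rule analytic_continuation_open[where s = "{s. Re s > 1}" and s' = "{s. Re s > 0} - {1}"
    and f = "\<lambda>s. (s - 1) * riemann_zeta s" and g = "\<lambda>s. 1 + (\<Sum>n. powr_step_rem 1 n s)"])
  show "open {s. Re s > 1}"
    by (rule open_halfspace_Re_gt)
  show "open ({s. Re s > 0} - {1})"
    by (intro open_delete open_halfspace_Re_gt)
  show "{s. Re s > 1} \<noteq> {}"
    by (auto intro: exI[of _ 2])
  show "connected ({s. Re s > 0} - {1})"
    by (intro connected_open_delete open_halfspace_Re_gt convex_connected convex_halfspace_Re_gt) simp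
  have "riemann_zeta holomorphic_on ({s. Re s > 0} - {1})"
    using riemann_zeta_props by (auto intro: holomorphic_on_subset)
  thus "(\<lambda>s. (s - 1) * riemann_zeta s) holomorphic_on ({s. Re s > 0} - {1})"
    by (intro holomorphic_intros)
  have "(\<lambda>s. \<Sum>n. powr_step_rem 1 n s) holomorphic_on ({s. Re s > 0} - {1})"
    by (rule holomorphic_on_subset[OF holomorphic_on_suminf_powr_step_rem[of 1]]) auto
  thus "(\<lambda>s. 1 + (\<Sum>n. powr_step_rem 1 n s)) holomorphic_on ({s. Re s > 0} - {1})"
    by (intro holomorphic_intros)
  show "(s - 1) * riemann_zeta s = 1 + (\<Sum>n. powr_step_rem 1 n s)" if "s \<in> {s. Re s > 1}" for s
    using that suminf_powr_step_rem'[of s 0] riemann_zeta_props by simp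
qed (use assms in auto)

text \<open>At \<open>s = 1/2\<close> the partial sums of the remainders of order 1 telescope to
  \<open>sqrt (M + 1) - 1\<close> minus half the sum of the inverse square roots.\<close>

lemma riemann_zeta_real_half_tendsto:
  "(\<lambda>M. (\<Sum>m<M. 1 / sqrt (real (Suc m))) - 2 * sqrt (real (Suc M))) \<longlonglongrightarrow> riemann_zeta_real (1/2)"
proof -
  have term_eq: "powr_step_rem 1 n (1/2) =
     of_real (sqrt (real (Suc (Suc n))) - sqrt (real (Suc n)) - 1/2 * (1 / sqrt (real (Suc n))))" for n
  proof -
    have "of_nat (Suc m) powr (of_real x :: complex) = of_real (real (Suc m) powr x)" for m x
      using powr_of_real[of "real (Suc m)" x] by simp
    note this[of _ "1/2"] this[of _ "-1/2"]
    hence "of_nat (Suc m) powr (1/2 :: complex) = of_real (sqrt (real (Suc m)))"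
      "of_nat (Suc m) powr (-1/2 :: complex) = of_real (1 / sqrt (real (Suc m)))" for m
      using powr_minus_divide[of "real (Suc m)" "1/2"] by (simp_all add: powr_half_sqrt del: of_nat_Suc)
    thus ?thesis
      by (simp add: powr_step_rem_def of_nat_1[unfolded One_nat_def] del: of_nat_Suc)
  qed
  have "(\<lambda>n. powr_step_rem 1 n (1/2)) sums ((1/2 - 1) * riemann_zeta (1/2) - 1)"
    using summable_sums[OF summable_powr_step_rem[of "1/2" 1]]
      riemann_zeta_eq_suminf_powr_step_rem[of "1/2"] by simp
  from sums_Re[OF this] have "(\<lambda>M. \<Sum>n<M. sqrt (real (Suc (Suc n))) - sqrt (real (Suc n)) -
      1/2 * (1 / sqrt (real (Suc n)))) \<longlonglongrightarrow> - riemann_zeta_real (1/2) / 2 - 1"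
    unfolding term_eq Re_complex_of_real by (simp add: sums_def riemann_zeta_real_def)
  moreover have "(\<Sum>n<M. sqrt (real (Suc (Suc n))) - sqrt (real (Suc n)) - 1/2 * (1 / sqrt (real (Suc n))))
     = sqrt (real (Suc M)) - 1 - 1/2 * (\<Sum>n<M. 1 / sqrt (real (Suc n)))" for M
    using sum_lessThan_telescope[of "\<lambda>n. sqrt (real (Suc n))" M]
    by (simp add: sum_subtractf sum_distrib_left del: of_nat_Suc)
  ultimately have "(\<lambda>M. sqrt (real (Suc M)) - 1 - 1/2 * (\<Sum>n<M. 1 / sqrt (real (Suc n))))
     \<longlonglongrightarrow> - riemann_zeta_real (1/2) / 2 - 1"
    by simp
  \<comment> \<open>Adding 1 and multiplying by -2 isolates zeta(1/2).\<close>
  from tendsto_mult[OF tendsto_const[of "-2"] tendsto_add[OF this tendsto_const[of 1]]]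
  show ?thesis
    by (simp add: algebra_simps)
qed

lemma riemann_zeta_real_sums:
  assumes "x > 1"
  shows "(\<lambda>m. real (Suc m) powr (-x)) sums riemann_zeta_real x"
proof -
  have "1 / of_nat (Suc m) powr (of_real x :: complex) = of_real (real (Suc m) powr (-x))" for m
    using powr_of_real[of "real (Suc m)" x] by (simp add: powr_minus_divide)
  moreover have "(\<lambda>m. 1 / of_nat (Suc m) powr (of_real x :: complex)) sums riemann_zeta (of_real x)"
    using riemann_zeta_props summable_sums[OF summable_dirichlet[of "of_real x"]] assms by simp
  ultimately show ?thesis
    using sums_Re[of _ "riemann_zeta (of_real x)"] unfolding riemann_zeta_real_def by fastforce
qed

section \<open>Binomial coefficients of 1/2 and the terms of the constant\<close>

text \<open>Links the central binomial coefficients in \<open>C_summand\<close> to the expansion of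
  the square root.\<close>

lemma gbinomial_half:
  "((1/2 :: real) gchoose k) = (-1) ^ (k + 1) / ((2 * real k - 1) * 4 ^ k) * real ((2 * k) choose k)"
proof (induction k)
  case (Suc k)
  have nz: "2 * real k - 1 \<noteq> 0"
  proof
    assume "2 * real k - 1 = 0"
    hence "real (2 * k) = real 1" by simp
    hence "2 * k = 1" by (simp only: of_nat_eq_iff)
    thus False by presburger
  qed
  \<comment> \<open>Two absorptions, joined by the symmetry of row \<open>2 * k + 1\<close>, give
    the recurrence of the central binomial coefficients.\<close>
  have "Suc k * ((2 * Suc k) choose Suc k) = 2 * (Suc k * ((2 * k + 1) choose k))"
    using binomial_absorption[of k "2 * Suc k"] by simp
  also have "((2 * k + 1) choose k) = ((2 * k + 1) choose Suc k)"
    using binomial_symmetric[of k "2 * k + 1"] by simp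
  also have "2 * (Suc k * ((2 * k + 1) choose Suc k)) = 2 * (2 * k + 1) * ((2 * k) choose k)"
    using binomial_absorption[of k "2 * k + 1"] by simp
  finally have "Suc k * ((2 * Suc k) choose Suc k) = 2 * (2 * k + 1) * ((2 * k) choose k)" .
  hence "real (Suc k * ((2 * Suc k) choose Suc k)) = real (2 * (2 * k + 1) * ((2 * k) choose k))"
    by (simp only:)
  hence ch: "real ((2 * Suc k) choose Suc k) = 2 * (2 * real k + 1) * real ((2 * k) choose k) / real (Suc k)"
    by (simp add: field_simps)
  have "((1/2 :: real) gchoose Suc k) = ((1/2) gchoose k) * (1/2 - real k) / real (Suc k)"
    using gbinomial_mult_diff[of "1/2 :: real" k] by (simp add: field_simps)
  also have "\<dots> = (-1) ^ (Suc k + 1) / ((2 * real (Suc k) - 1) * 4 ^ Suc k) * real ((2 * Suc k) choose Suc k)"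
    unfolding Suc.IH ch using nz by (simp add: divide_simps) (simp add: algebra_simps)
  finally show ?case .
qed auto

lemma abs_gbinomial_half_le: "\<bar>(1/2 :: real) gchoose k\<bar> \<le> 1"
proof (cases k)
  case (Suc j)
  have "real ((2 * k) choose k) \<le> real (2 ^ (2 * k))"
    by (intro of_nat_mono binomial_le_pow2)
  also have "\<dots> = 4 ^ k"
    by (simp add: power_mult)
  also have "(4::real) ^ k \<le> (2 * real k - 1) * 4 ^ k"
    using Suc by simp
  finally show ?thesis
    using Suc unfolding gbinomial_half abs_mult abs_divide by (simp add: divide_simps)
qed simp

text \<open>Since 8^k = 4^k 2^k, the coefficient is that of m^(-k) in the expansion of sqrt(1 +
  1/(2m)).\<close>

lemma C_summand_altdef:
  "C_summand k = ((1/2 :: real) gchoose k) / 2 ^ k * riemann_zeta_real (real k - 1/2)"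
proof -
  have "(8::real) ^ k = 4 ^ k * 2 ^ k"
    by (simp flip: power_mult_distrib)
  thus ?thesis
    by (simp add: C_summand_def gbinomial_half)
qed

section \<open>The convergent part of the paired sum\<close>

text \<open>One paired step with its \<open>k = 1\<close> binomial term removed; what is left is of
  order m^(-3/2), hence summable.\<close>

definition sqrt_step_tail :: "nat \<Rightarrow> real" where
  "sqrt_step_tail m = sqrt (2 * real (Suc m) + 1) - sqrt (2 * real (Suc m))
     - sqrt 2 / 4 * (1 / sqrt (real (Suc m)))"

text \<open>The binomial series of \<open>sqrt (2 * x + 1)\<close> around \<open>2 * x\<close>,
  without its first two terms; the powers of 2 come from splitting
  \<open>(2 * x) powr (1/2 - (k + 2))\<close>.\<close>

lemma sqrt_step_tail_sums:
  "(\<lambda>k. sqrt 2 * (((1/2) gchoose (k + 2)) / 2 ^ (k + 2)) * real (Suc m) powr (- (real k + 3/2))) sums sqrt_step_tail m"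
proof -
  define x where "x = real (Suc m)"
  have x: "x \<ge> 1"
    by (simp add: x_def)
  have "(\<lambda>n. ((1/2) gchoose n) * (2 * x) powr (1/2 - real n) * 1 ^ n) sums sqrt (2 * x + 1)"
    using x by (intro sqrt_series') auto
  from sums_split_initial_segment[OF this, of 2]
  have "(\<lambda>n. ((1/2) gchoose (n + 2)) * (2 * x) powr (1/2 - real (n + 2))) sums
     (sqrt (2 * x + 1) - (sqrt (2 * x) + 1/2 * (2 * x) powr (- 1/2)))"
    using x by (simp add: powr_half_sqrt numeral_2_eq_2)
  moreover have "1/2 * (2 * x) powr (- 1/2) = sqrt 2 / 4 * (1 / sqrt x)"
  proof -
    have "(2 * x) powr (- 1/2) = 1 / (sqrt 2 * sqrt x)"
      using x powr_minus_divide[of "2 * x" "1/2"] by (simp add: powr_half_sqrt real_sqrt_mult)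
    also have "\<dots> = sqrt 2 / 2 * (1 / sqrt x)"
      using x by (simp add: field_simps)
    finally show ?thesis
      by simp
  qed
  moreover have "(2 * x) powr (1/2 - real (n + 2)) = sqrt 2 / 2 ^ (n + 2) * x powr (- (real n + 3/2))" for n
  proof -
    have "2 powr (1/2 - real (n + 2)) = sqrt 2 / 2 ^ (n + 2)"
      unfolding powr_diff by (subst powr_realpow) (simp_all add: powr_half_sqrt)
    moreover have "1/2 - real (n + 2) = - (real n + 3/2)"
      by simp
    moreover have "(2 * x) powr (1/2 - real (n + 2)) = 2 powr (1/2 - real (n + 2)) * x powr (1/2 - real (n + 2))"
      by (rule powr_mult)
    ultimately show ?thesis
      by (simp only:)
  qed
  ultimately show ?thesis
    unfolding sqrt_step_tail_def x_def[symmetric] by (simp add: algebra_simps)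
qed

text \<open>Tannery's theorem exchanges the limit in \<open>M\<close> with the sum over
  \<open>k\<close>; a geometric sequence times zeta(3/2) dominates uniformly in
  \<open>M\<close>.\<close>

lemma sqrt_step_tail_sum_tendsto:
  "summable (\<lambda>k. C_summand (k + 2))"
  "(\<lambda>M. \<Sum>m<M. sqrt_step_tail m) \<longlonglongrightarrow> sqrt 2 * (\<Sum>k. C_summand (k + 2))"
proof -
  define c where "c = (\<lambda>k. sqrt 2 * (((1/2) gchoose (k + 2)) / 2 ^ (k + 2)) :: real)"
  define a where "a = (\<lambda>k M. c k * (\<Sum>m<M. real (Suc m) powr (- (real k + 3/2))))"
  \<comment> \<open>This is zeta(3/2); as all bases are at least 1, it bounds the partial sums for
    every \<open>k\<close>.\<close>
  define Z where "Z = (\<Sum>m. real (Suc m) powr (- (3/2)))"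
  have Z: "summable (\<lambda>m. real (Suc m) powr (- (3/2)))"
    by (rule summable_powr_Suc) auto
  have c_le: "\<bar>c k\<bar> \<le> sqrt 2 * (1/2) ^ k" for k
  proof -
    have "\<bar>c k\<bar> = sqrt 2 * (\<bar>(1/2) gchoose (k + 2)\<bar> / 2 ^ (k + 2))"
      by (simp add: c_def abs_mult)
    also have "\<dots> \<le> sqrt 2 * (1 / 2 ^ k)"
      by (intro mult_left_mono frac_le abs_gbinomial_half_le) (auto intro: power_increasing)
    finally show ?thesis
      by (simp add: power_divide)
  qed
  have lim: "(\<lambda>M. a k M) \<longlonglongrightarrow> sqrt 2 * C_summand (k + 2)" for k
  proof -
    have "(\<lambda>M. \<Sum>m<M. real (Suc m) powr (- (real k + 3/2))) \<longlonglongrightarrow> riemann_zeta_real (real k + 3/2)"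
      using riemann_zeta_real_sums[of "real k + 3/2"] by (simp add: sums_def)
    moreover have "real (k + 2) - 1/2 = real k + 3/2"
      by simp
    hence "sqrt 2 * C_summand (k + 2) = c k * riemann_zeta_real (real k + 3/2)"
      by (simp only: C_summand_altdef c_def mult.assoc)
    ultimately show ?thesis
      unfolding a_def by (simp only:) (intro tendsto_mult tendsto_const)
  qed
  have bound: "norm (a k M) \<le> sqrt 2 * (1/2) ^ k * Z" for k M
  proof -
    have "(\<Sum>m<M. real (Suc m) powr (- (real k + 3/2))) \<le> (\<Sum>m<M. real (Suc m) powr (- (3/2)))"
      by (intro sum_mono powr_mono) auto
    also have "\<dots> \<le> Z"
      unfolding Z_def by (intro sum_le_suminf Z) auto
    finally show ?thesis
      unfolding a_def real_norm_def abs_mult using c_le[of k]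
      by (intro mult_mono) (auto simp: sum_nonneg)
  qed
  have "summable (\<lambda>k. sqrt 2 * (1/2) ^ k * Z)"
    by (intro summable_mult2 summable_mult summable_geometric) auto
  from tannerys_theorem[of a, OF lim _ this] bound
  have *: "summable (\<lambda>k. norm (sqrt 2 * C_summand (k + 2)))"
    "(\<lambda>M. \<Sum>k. a k M) \<longlonglongrightarrow> (\<Sum>k. sqrt 2 * C_summand (k + 2))"
    by (auto simp: always_eventually case_prod_unfold)
  have "summable (\<lambda>k. sqrt 2 * C_summand (k + 2))"
    using *(1) by (rule summable_norm_cancel)
  thus sm: "summable (\<lambda>k. C_summand (k + 2))"
    by (subst (asm) summable_cmult_iff) auto
  have "(\<Sum>k. a k M) = (\<Sum>m<M. sqrt_step_tail m)" for M
  proof -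
    have "(\<lambda>k. \<Sum>m<M. c k * real (Suc m) powr (- (real k + 3/2))) sums (\<Sum>m<M. sqrt_step_tail m)"
      unfolding c_def by (intro sums_sum sqrt_step_tail_sums)
    thus ?thesis
      by (simp add: a_def sum_distrib_left sums_iff)
  qed
  with *(2) sm show "(\<lambda>M. \<Sum>m<M. sqrt_step_tail m) \<longlonglongrightarrow> sqrt 2 * (\<Sum>k. C_summand (k + 2))"
    by (simp add: suminf_mult)
qed

section \<open>The alternating sum and its limit\<close>

abbreviation alt_sqrt_sum :: "nat \<Rightarrow> real" where
  "alt_sqrt_sum n \<equiv> \<Sum>j=1..n. (-1) ^ (j + 1) * sqrt (real j)"

lemma alt_sqrt_sum_step:
  "alt_sqrt_sum (2 * Suc M + 1) = alt_sqrt_sum (2 * M + 1) + sqrt (2 * real M + 3) - sqrt (2 * real M + 2)"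
  by (simp add: algebra_simps)

text \<open>The \<open>k = 1\<close> contributions are kept apart because their sum diverges and
  must be balanced through zeta(1/2).\<close>

lemma alt_sqrt_sum_odd:
  "alt_sqrt_sum (2 * M + 1) = 1 + (\<Sum>m<M. sqrt_step_tail m) + sqrt 2 / 4 * (\<Sum>m<M. 1 / sqrt (real (Suc m)))"
proof (induction M)
  case (Suc M)
  show ?case
    unfolding alt_sqrt_sum_step Suc.IH by (simp add: sqrt_step_tail_def algebra_simps)
qed auto

text \<open>With n = 2M+1, this is the sum in the theorem minus n/2 and 1/8, all divided by sqrt n;
  only C should remain.\<close>

definition alt_sqrt_rem :: "nat \<Rightarrow> real" where
  "alt_sqrt_rem M = alt_sqrt_sum (2 * M + 1) - sqrt (2 * real M + 1) / 2 - 1 / (8 * sqrt (2 * real M + 1))"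

lemma alt_sqrt_rem_tendsto: "alt_sqrt_rem \<longlonglongrightarrow> C_const"
proof -
  define \<zeta> where "\<zeta> = riemann_zeta_real (1/2)"
  have "summable (\<lambda>k. C_summand (Suc k))"
    using sqrt_step_tail_sum_tendsto(1) summable_Suc_iff[of "\<lambda>k. C_summand (Suc k)"] by simp
  hence "(\<Sum>k. C_summand (Suc k)) = C_summand 1 + (\<Sum>k. C_summand (k + 2))"
    using suminf_split_head[of "\<lambda>k. C_summand (Suc k)"] by simp
  moreover have "C_summand 1 = \<zeta> / 4"
    by (simp add: C_summand_altdef \<zeta>_def)
  \<comment> \<open>The \<open>+ 0\<close> matches the shape of the limit assembled by
    \<open>tendsto_add\<close> below.\<close>
  ultimately have C: "C_const = 1 + sqrt 2 * (\<Sum>k. C_summand (k + 2)) + sqrt 2 / 4 * \<zeta> + 0"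
    by (simp add: C_const_def algebra_simps)
  \<comment> \<open>With y = 2M+2: \<open>sqrt 2 / 4\<close> times the compensating
    \<open>2 * sqrt (M + 1)\<close> equals \<open>sqrt y / 2\<close>, which cancels the main term
    \<open>sqrt (y - 1) / 2\<close> up to o(1).\<close>
  have "((\<lambda>y::real. sqrt y / 2 - sqrt (y - 1) / 2 - 1 / (8 * sqrt (y - 1))) \<longlongrightarrow> 0) at_top"
    by real_asymp
  moreover have "filterlim (\<lambda>M. 2 * real M + 2) at_top sequentially"
    by real_asymp
  ultimately have "(\<lambda>M. sqrt (2 * real M + 2) / 2 - sqrt (2 * real M + 2 - 1) / 2
      - 1 / (8 * sqrt (2 * real M + 2 - 1))) \<longlonglongrightarrow> 0"
    by (rule filterlim_compose)
  moreover have "sqrt (2 * real M + 2) = sqrt 2 * sqrt (real (Suc M))" for M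
    by (simp flip: real_sqrt_mult add: algebra_simps)
  ultimately have "(\<lambda>M. sqrt 2 / 4 * (2 * sqrt (real (Suc M))) - sqrt (2 * real M + 1) / 2
      - 1 / (8 * sqrt (2 * real M + 1))) \<longlonglongrightarrow> 0"
    by (simp add: add_diff_eq[symmetric] mult.assoc)
  note tendsto_add[OF tendsto_add[OF tendsto_add[OF tendsto_const[of 1] sqrt_step_tail_sum_tendsto(2)]
    tendsto_mult[OF tendsto_const[of "sqrt 2 / 4"] riemann_zeta_real_half_tendsto]] this]
  thus ?thesis
    unfolding C \<zeta>_def alt_sqrt_rem_def alt_sqrt_sum_odd
    by (rule Lim_transform_eventually) (simp add: right_diff_distrib del: of_nat_Suc)
qed

section \<open>Rate of convergence\<close>

text \<open>Adding the increments from \<open>M\<close> to \<open>j + M\<close> telescopes the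
  right-hand side; then \<open>j\<close> tends to infinity.\<close>

lemma tendsto_telescope_bound:
  fixes E u :: "nat \<Rightarrow> real"
  assumes E: "E \<longlonglongrightarrow> C" and u: "u \<longlonglongrightarrow> 0"
    and step: "\<And>M. M \<ge> N \<Longrightarrow> \<bar>E (Suc M) - E M\<bar> \<le> K * (u M - u (Suc M))"
    and M: "M \<ge> N"
  shows "\<bar>E M - C\<bar> \<le> K * u M"
proof -
  have lim: "(\<lambda>j. K * (u M - u (j + M))) \<longlonglongrightarrow> K * (u M - 0)"
    by (intro tendsto_intros LIMSEQ_ignore_initial_segment u)
  have "\<bar>E (j + M) - E M\<bar> \<le> K * (u M - u (j + M))" for j
  proof (induction j)
    case (Suc j)
    show ?case
      using Suc.IH step[of "j + M"] M by (simp add: algebra_simps)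
  qed simp
  moreover have "(\<lambda>j. \<bar>E (j + M) - E M\<bar>) \<longlonglongrightarrow> \<bar>C - E M\<bar>"
    by (intro tendsto_intros LIMSEQ_ignore_initial_segment E)
  ultimately have "\<bar>C - E M\<bar> \<le> K * (u M - 0)"
    using lim by (intro LIMSEQ_le) auto
  thus ?thesis
    by (simp add: abs_minus_commute)
qed

text \<open>The coefficient 1/8 cancels the M^(-3/2) terms of the increments, which are therefore
  dominated by the M^(-5/2) increments of \<open>u\<close>. The exponent 3 is what the theorem
  needs: sqrt n times n^(-3/2) is 1/n.\<close>

lemma alt_sqrt_rem_bound:
  "\<exists>K N. \<forall>M\<ge>N. \<bar>alt_sqrt_rem M - C_const\<bar> \<le> K * (1 / sqrt (2 * real M + 1) ^ 3)"
proof -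
  define u where "u = (\<lambda>M. 1 / sqrt (2 * real M + 1) ^ 3)"
  \<comment> \<open>Writing y = 2 M + 2 avoids the irrational expansion coefficients that \<open>real_asymp\<close> cannot compare.\<close>
  have "(\<lambda>y::real. sqrt (y + 1) - sqrt y - sqrt (y + 1) / 2 - 1 / (8 * sqrt (y + 1))
      + sqrt (y - 1) / 2 + 1 / (8 * sqrt (y - 1)))
     \<in> O(\<lambda>y. 1 / sqrt (y - 1) ^ 3 - 1 / sqrt (y + 1) ^ 3)"
    by real_asymp
  moreover have "filterlim (\<lambda>M. 2 * real M + 2) at_top sequentially"
    by real_asymp
  ultimately have "(\<lambda>M. sqrt (2 * real M + 2 + 1) - sqrt (2 * real M + 2) - sqrt (2 * real M + 2 + 1) / 2
      - 1 / (8 * sqrt (2 * real M + 2 + 1)) + sqrt (2 * real M + 2 - 1) / 2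
      + 1 / (8 * sqrt (2 * real M + 2 - 1)))
     \<in> O(\<lambda>M. 1 / sqrt (2 * real M + 2 - 1) ^ 3 - 1 / sqrt (2 * real M + 2 + 1) ^ 3)"
    by (rule landau_o.big.compose)
  also have "(\<lambda>M. sqrt (2 * real M + 2 + 1) - sqrt (2 * real M + 2) - sqrt (2 * real M + 2 + 1) / 2
      - 1 / (8 * sqrt (2 * real M + 2 + 1)) + sqrt (2 * real M + 2 - 1) / 2
      + 1 / (8 * sqrt (2 * real M + 2 - 1))) =
     (\<lambda>M. alt_sqrt_rem (Suc M) - alt_sqrt_rem M)"
    unfolding alt_sqrt_rem_def alt_sqrt_sum_step by (intro ext) (simp add: algebra_simps)
  also have "(\<lambda>M. 1 / sqrt (2 * real M + 2 - 1) ^ 3 - 1 / sqrt (2 * real M + 2 + 1) ^ 3) =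
     (\<lambda>M. u M - u (Suc M))"
    unfolding u_def by (intro ext) (simp add: algebra_simps)
  finally obtain K where "eventually (\<lambda>M. \<bar>alt_sqrt_rem (Suc M) - alt_sqrt_rem M\<bar> \<le> K * \<bar>u M - u (Suc M)\<bar>) sequentially"
    by (elim landau_o.bigE) auto
  then obtain N where N: "\<And>M. M \<ge> N \<Longrightarrow> \<bar>alt_sqrt_rem (Suc M) - alt_sqrt_rem M\<bar> \<le> K * \<bar>u M - u (Suc M)\<bar>"
    unfolding eventually_sequentially by blast
  \<comment> \<open>Monotonicity removes the absolute value, so that the bound telescopes.\<close>
  have "u (Suc M) \<le> u M" for M
    unfolding u_def by (intro divide_left_mono power_mono mult_pos_pos) auto
  with N have "\<bar>alt_sqrt_rem (Suc M) - alt_sqrt_rem M\<bar> \<le> K * (u M - u (Suc M))" if "M \<ge> N" for M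
    using that by (metis abs_of_nonneg diff_ge_0_iff_ge)
  moreover have "u \<longlonglongrightarrow> 0"
    unfolding u_def by real_asymp
  ultimately have "\<bar>alt_sqrt_rem M - C_const\<bar> \<le> K * u M" if "M \<ge> N" for M
    using tendsto_telescope_bound[OF alt_sqrt_rem_tendsto] that by blast
  thus ?thesis
    unfolding u_def by blast
qed

section \<open>From large indices to a bound for all odd n\<close>

theorem mainTheorem2:
  shows "\<exists>K::real. K > 0 \<and>
    (\<forall>n::nat. odd n \<longrightarrow>
      \<bar>(\<Sum>j=1..n. (-1) ^ (j + 1) * sqrt (real j * real n))
        - real n / 2 - C_const * sqrt (real n) - 1/8\<bar> \<le> K / real n)"
proof -
  define err where "err = (\<lambda>n::nat. (\<Sum>j=1..n. (-1) ^ (j + 1) * sqrt (real j * real n))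
        - real n / 2 - C_const * sqrt (real n) - 1/8)"
  \<comment> \<open>A factor sqrt n comes out of every term, 1/8 becoming 1/(8 sqrt n).\<close>
  have err_eq: "err (2 * M + 1) = sqrt (real (2 * M + 1)) * (alt_sqrt_rem M - C_const)" for M
  proof -
    define r where "r = sqrt (2 * real M + 1)"
    have r: "r > 0" "real (2 * M + 1) = r ^ 2" "sqrt (real (2 * M + 1)) = r"
      by (simp_all add: r_def)
    have "err (2 * M + 1) = r * alt_sqrt_sum (2 * M + 1) - r ^ 2 / 2 - C_const * r - 1/8"
      unfolding err_def real_sqrt_mult r(2,3) sum_distrib_left using r(1)
      by (intro arg_cong2[where f = "(-)"] sum.cong refl) auto
    also have "\<dots> = r * (alt_sqrt_sum (2 * M + 1) - r / 2 - 1 / (8 * r) - C_const)"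
      using r(1) by (simp add: field_simps power2_eq_square)
    finally show ?thesis
      unfolding alt_sqrt_rem_def r(3) by (simp add: r_def)
  qed
  obtain K N where KN: "\<And>M. M \<ge> N \<Longrightarrow> \<bar>alt_sqrt_rem M - C_const\<bar> \<le> K * (1 / sqrt (2 * real M + 1) ^ 3)"
    using alt_sqrt_rem_bound by blast
  \<comment> \<open>The sum covers the finitely many \<open>M < N\<close>; the 1 ensures
    positivity.\<close>
  define K' where "K' = \<bar>K\<bar> + (\<Sum>M<N. real (2 * M + 1) * \<bar>err (2 * M + 1)\<bar>) + 1"
  have S: "(\<Sum>M<N. real (2 * M + 1) * \<bar>err (2 * M + 1)\<bar>) \<ge> 0"
    by (intro sum_nonneg) auto
  have "\<bar>err n\<bar> \<le> K' / real n" if "odd n" for n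
  proof -
    obtain M where n: "n = 2 * M + 1"
      using \<open>odd n\<close> by (rule oddE)
    have "real n * \<bar>err n\<bar> \<le> K'"
    proof (cases "M \<ge> N")
      case True
      define r where "r = sqrt (real n)"
      have r: "r > 0" "real n = r ^ 2" "r = sqrt (2 * real M + 1)"
        by (simp_all add: r_def n)
      have "\<bar>err n\<bar> = r * \<bar>alt_sqrt_rem M - C_const\<bar>"
        unfolding n err_eq using r(1) by (simp add: abs_mult r_def n)
      hence "real n * \<bar>err n\<bar> = r ^ 3 * \<bar>alt_sqrt_rem M - C_const\<bar>"
        by (simp add: r(2) power2_eq_square power3_eq_cube)
      also have "\<dots> \<le> r ^ 3 * (K * (1 / r ^ 3))"
        using KN[OF True] r by (intro mult_left_mono) auto
      also have "\<dots> = K"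
        using r(1) by simp
      finally show ?thesis
        using S by (simp add: K'_def)
    next
      case False
      hence "real n * \<bar>err n\<bar> \<le> (\<Sum>M<N. real (2 * M + 1) * \<bar>err (2 * M + 1)\<bar>)"
        unfolding n by (intro member_le_sum[where f = "\<lambda>M. real (2 * M + 1) * \<bar>err (2 * M + 1)\<bar>"]) auto
      thus ?thesis
        by (simp add: K'_def)
    qed
    thus ?thesis
      by (simp add: n field_simps)
  qed
  moreover have "K' > 0"
    using S by (simp add: K'_def)
  ultimately show ?thesis
    unfolding err_def by blast
qed

end
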